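(* Suppose that the following three hypotheses hold. (Permutation) $\widehat A_{\mathfrak h,\eta}\equiv\widehat A_{\eta,\mathfrak h}$ for all $\mathfrak h,\eta\in\mathfrak H$. (Upper function) For every $n\ge 1$, $$\sup_{f\in\mathbb F}\mathbb E^{(n)}_{1,f}\Big(\sup_{\mathfrak h\in\mathfrak H_n}\big[\ell(\widehat A_{\mathfrak h},\Lambda_{\mathfrak h}(f))-\Psi_n(\mathfrak h)\big]_+^q\Big)\le\varepsilon_n^q,$$ $$\sup_{f\in\mathbb F}\mathbb E^{(n)}_{1,f}\Big(\sup_{\mathfrak h,\eta\in\mathfrak H_n}\big[\ell(\widehat A_{\mathfrak h,\eta},\Lambda_{\mathfrak h,\eta}(f))-\min\{\Psi_n(\mathfrak h),\Psi_n(\eta)\}\big]_+^q\Big)\le\varepsilon_n^q.$$ (Concentration) There is a constant $C_\Psi\ge1$ such that for every $n\ge1$ $$\sup_{f\in\mathbb F}\mathbb E^{(n)}_{1,f}\Big(\sup_{\mathfrak h\in\mathfrak H_n}\big[\Psi_n(\mathfrak h)-C_\Psi\psi_n(f,\mathfrak h)\big]_+^q\Big)\le\varepsilon_n^q,\qquad \sup_{f\in\mathbb F}\mathbb E^{(n)}_{1,f}\Big(\sup_{\mathfrak h\in\mathfrak H_n}\big[\psi_n(f,\mathfrak h)-C_\Psi\Psi_n(\mathfrak h)\big]_+^q\Big)\le\varepsilon_n^q.$$ Let $\delta_n=\inf_{f\in\mathbb F}\inf_{\mathfrak h\in\mathfrak H_n}\psi_n(f,\mathfrak h)>0$, and let $\hat{\mathfrak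 h}^{(n)}$ be selected by the $(\Psi_n,\ell)$-selection rule with $\varepsilon_n'\le\delta_n/4$. Define $$\mathfrak V_n(f)=\Big\{\mathfrak h\in\mathfrak H_n:\ \psi_n(f,\mathfrak h)<2C_\Psi^2\inf_{\eta\in\mathfrak H_n}\big[\mathcal B_A^{(n)}(f,\eta)+2\psi_n(f,\eta)\big]\Big\},$$ $$\mathfrak U_n(f)=\Big\{\mathfrak h\in\mathfrak H_n:\ \ell(\Lambda_{\mathfrak h}(f),A(f))<4C_\Psi\inf_{\eta\in\mathfrak H_n}\big[\mathcal B_A^{(n)}(f,\eta)+2\psi_n(f,\eta)\big]\Big\},$$ $$\tau_n(f)=\sup_{\mathfrak h\in\mathfrak V_n(f)}\mathcal E_n(f,\mathfrak h)+\frac{5\varepsilon_n}{\delta_n}\sup_{\mathfrak h\in\mathfrak H_n}\mathcal E_n(f,\mathfrak h),$$ $$\nu_n(f)=\sup_{\mathfrak h\in\mathfrak U_n(f)}\rho(\Upsilon_{\mathfrak h}(f),B(f))+\frac{30\varepsilon_n}{\delta_n}\sup_{\mathfrak h\in\mathfrak H_n}\rho(\Upsilon_{\mathfrak h}(f),B(f)).$$ Then for every $f\in\mathbb F$ and $n\ge1$ $$\mathcal R_B\big[\widehat B_{\hat{\mathfrak h}^{(n)}},f\big]\le\nu_n(f)+\tau_n(f).$$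
   Context: Setting. For each $n\ge1$ let $(\mathcal X^{(n)},\mathfrak T^{(n)},\mathbb P^{(n)}_f, f\in\mathbb F)$ be a statistical experiment generated by an observation $X^{(n)}=(X^{(n)}_1,X^{(n)}_2)$, where $X_1^{(n)},X_2^{(n)}$ are independent random elements with marginal laws $\mathbb P^{(n)}_{1,f},\mathbb P^{(n)}_{2,f}$; $\mathbb E^{(n)}_f,\mathbb E^{(n)}_{1,f},\mathbb E^{(n)}_{2,f}$ are the corresponding expectations. Let $A:\mathbb F\to\mathfrak S_1$ and $B:\mathbb F\to\mathfrak S_2$ be maps to be estimated, where $\mathfrak S_1,\mathfrak S_2$ are endowed with semi-metrics $\ell,\rho$ respectively. Let $q\ge1$ be fixed. For an $X^{(n)}$-measurable $\mathfrak S_2$-valued map $\widetilde Q$ put $\mathcal R_B[\widetilde Q,f]=\big(\mathbb E^{(n)}_f[\rho(\widetilde Q,B(f))]^q\big)^{1/q}$. Let $\mathfrak H$ be a parameter set, $\mathfrak H_n\subseteq\mathfrak H$ countable subsets, $\{\widehat A_{\mathfrak h}\}_{\mathfrak h\in\mathfrak H}$ and $\{\widehat A_{\mathfrak h,\eta}\}_{\mathfrak h,\eta\in\mathfrak H}$ families of $X_1^{(n)}$-measurable $\mathfrak S_1$-valued maps (possibly depending on $n$), $\{\Lambda_{\mathfrak h}(f)\}$ and $\{\Lambda_{\mathfrak h,\eta}(f)\}$ ($\mathfrak h,\eta\in\mathfrak H$, $f\in\mathbb F$) collections of $\mathfrak S_1$-valued functionals (possibly depending on $n$), and $\{\Psi_n(\mathfrak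 h)\}_{\mathfrak h\in\mathfrak H}$ positive $X_1^{(n)}$-measurable random variables. Let $\{\widehat B_{\mathfrak h}\}_{\mathfrak h\in\mathfrak H}$ be a family of $X_2^{(n)}$-measurable $\mathfrak S_2$-valued maps and $\{\Upsilon_{\mathfrak h}(f)\}$ ($\mathfrak h\in\mathfrak H$, $f\in\mathbb F$) a collection of $\mathfrak S_2$-valued functionals. Let $\varepsilon_n\ge0$, $\varepsilon_n\to0$, be a given sequence. Random quantities whose expectations appear are understood to be measurable. $[x]_+=\max(x,0)$. $(\Psi_n,\ell)$-selection rule. Put $$\widehat R_n(\mathfrak h)=\sup_{\eta\in\mathfrak H_n}\big[\ell(\widehat A_{\mathfrak h,\eta},\widehat A_\eta)-2\Psi_n(\eta)\big]_+,\quad \mathfrak h\in\mathfrak H_n,$$ and let $\hat{\mathfrak h}^{(n)}\in\mathfrak H_n$ be an arbitrary $X_1^{(n)}$-measurable random element satisfying $$\widehat R_n(\hat{\mathfrak h}^{(n)})+2\Psi_n(\hat{\mathfrak h}^{(n)})\le\inf_{\mathfrak h\in\mathfrak H_n}\{\widehat R_n(\mathfrak h)+2\Psi_n(\mathfrak h)\}+\varepsilon_n',$$ where $\varepsilon_n'$ is a sequence with $\varepsilon'_n\le\varepsilon_n$. Notation: for $f\in\mathbb F$, $\mathfrak h\in\mathfrak H_n$, $$\mathcal B^{(n)}_A(f,\mathfrak h)=\ell(\Lambda_{\mathfrak h}(f),A(f))+2\sup_{\eta\in\mathfrak H_n}\ell(\Lambda_{\mathfrak h,\eta}(f),\Lambda_\eta(f)),\qquad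 \psi_n(f,\mathfrak h)=\big[\mathbb E^{(n)}_{1,f}\{\Psi_n^q(\mathfrak h)\}\big]^{1/q},$$ $$\mathcal E_n(f,\mathfrak h)=\big(\mathbb E^{(n)}_{2,f}\{\rho^q(\widehat B_{\mathfrak h},\Upsilon_{\mathfrak h}(f))\}\big)^{1/q}.$$ *)

theory Defs
  imports "HOL-Probability.Probability"
begin

text \<open>All suprema, infima and expectations are taken in \<^typ>\<open>ennreal\<close>, so that they are meaningful
  without finiteness assumptions; there \<open>\<Squnion> \<emptyset> = 0\<close>, \<open>0 \<cdot> \<infinity> = 0\<close>, and a difference \<open>a - b\<close>
  is the positive part whenever \<open>a\<close> or \<open>b\<close> is finite. Expectations are nonnegative Lebesgue integrals.\<close>

text \<open>Powers of extended nonnegative reals, meant for exponents \<open>r > 0\<close> only.\<close>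

definition epowr :: "ennreal \<Rightarrow> real \<Rightarrow> ennreal" where
  "epowr x r = (if x = \<top> then \<top> else ennreal (enn2real x powr r))"

definition Lq_size :: "'a measure \<Rightarrow> real \<Rightarrow> ('a \<Rightarrow> ennreal) \<Rightarrow> ennreal" where
  "Lq_size M q g = epowr (\<integral>\<^sup>+ x. epowr (g x) q \<partial>M) (1 / q)"

text \<open>Distinct points may be at distance \<open>0\<close>.\<close>

definition semimetric_on :: "'a set \<Rightarrow> ('a \<Rightarrow> 'a \<Rightarrow> real) \<Rightarrow> bool" where
  "semimetric_on S d \<longleftrightarrow>
     (\<forall>x\<in>S. \<forall>y\<in>S. 0 \<le> d x y \<and> d x y = d y x) \<and>
     (\<forall>x\<in>S. d x x = 0) \<and>
     (\<forall>x\<in>S. \<forall>y\<in>S. \<forall>z\<in>S. d x z \<le> d x y + d y z)"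

text \<open>The data of the estimation problem. A statistic measurable with respect to the first
  (second) component of the observation is a measurable function on \<open>obs1 S n\<close> (\<open>obs2 S n\<close>)
  that is composed with \<open>X1 S n\<close> (\<open>X2 S n\<close>). The spaces of values \<open>val1\<close> and \<open>val2\<close> carry
  arbitrary sigma-algebras (not tied to the semi-metrics).

  \<open>funcs\<close> is the class \<open>\<bbbF>\<close>, \<open>params\<close> is \<open>\<HH>\<close>, \<open>grid S n\<close> is \<open>\<HH>\<^sub>n\<close>; \<open>Ahat S n h\<close> and
  \<open>Ahat2 S n h \<eta>\<close> are the one- and two-index estimators, \<open>Lam\<close> and \<open>Lam2\<close> the functionals
  attached to them.\<close>

record ('w, 'x, 'y, 'f, 'h, 's, 't) selection_model =
  sample :: "nat \<Rightarrow> 'w measure"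
  pmeas :: "nat \<Rightarrow> 'f \<Rightarrow> 'w measure"
  obs1 :: "nat \<Rightarrow> 'x measure"
  obs2 :: "nat \<Rightarrow> 'y measure"
  X1 :: "nat \<Rightarrow> 'w \<Rightarrow> 'x"
  X2 :: "nat \<Rightarrow> 'w \<Rightarrow> 'y"
  funcs :: "'f set"
  params :: "'h set"
  grid :: "nat \<Rightarrow> 'h set"
  qexp :: real
  val1 :: "'s measure"
  ell :: "'s \<Rightarrow> 's \<Rightarrow> real"
  Amap :: "'f \<Rightarrow> 's"
  Ahat :: "nat \<Rightarrow> 'h \<Rightarrow> 'x \<Rightarrow> 's"
  Ahat2 :: "nat \<Rightarrow> 'h \<Rightarrow> 'h \<Rightarrow> 'x \<Rightarrow> 's"
  Lam :: "nat \<Rightarrow> 'h \<Rightarrow> 'f \<Rightarrow> 's"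
  Lam2 :: "nat \<Rightarrow> 'h \<Rightarrow> 'h \<Rightarrow> 'f \<Rightarrow> 's"
  Psi :: "nat \<Rightarrow> 'h \<Rightarrow> 'x \<Rightarrow> real"
  val2 :: "'t measure"
  rho :: "'t \<Rightarrow> 't \<Rightarrow> real"
  Bmap :: "'f \<Rightarrow> 't"
  Bhat :: "nat \<Rightarrow> 'h \<Rightarrow> 'y \<Rightarrow> 't"
  Ups :: "nat \<Rightarrow> 'h \<Rightarrow> 'f \<Rightarrow> 't"
  eps :: "nat \<Rightarrow> real"

definition law1 where
  "law1 S n f = distr (pmeas S n f) (obs1 S n) (X1 S n)"

definition law2 where
  "law2 S n f = distr (pmeas S n f) (obs2 S n) (X2 S n)"

definition upper_dev where
  "upper_dev S n f x =
     (SUP h\<in>grid S n.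
        epowr (ennreal (max 0 (ell S (Ahat S n h x) (Lam S n h f) - Psi S n h x))) (qexp S))"

definition upper_dev2 where
  "upper_dev2 S n f x =
     (SUP h\<in>grid S n. SUP \<eta>\<in>grid S n.
        epowr (ennreal (max 0 (ell S (Ahat2 S n h \<eta> x) (Lam2 S n h \<eta> f)
                               - min (Psi S n h x) (Psi S n \<eta> x)))) (qexp S))"

text \<open>Independence of \<open>X1\<close> and \<open>X2\<close> is that of the sigma-algebras they generate:
  \<open>indep_var\<close> requires both random elements to have the same value type.\<close>

definition is_selection_model where
  "is_selection_model S \<longleftrightarrow>
     1 \<le> qexp S \<and>
     semimetric_on (space (val1 S)) (ell S) \<and>
     semimetric_on (space (val2 S)) (rho S) \<and>
     Amap S \<in> funcs S \<rightarrow> space (val1 S) \<and>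
     Bmap S \<in> funcs S \<rightarrow> space (val2 S) \<and>
     eps S \<longlonglongrightarrow> 0 \<and>
     (\<forall>n\<ge>1.
        0 \<le> eps S n \<and>
        X1 S n \<in> sample S n \<rightarrow>\<^sub>M obs1 S n \<and>
        X2 S n \<in> sample S n \<rightarrow>\<^sub>M obs2 S n \<and>
        (\<forall>f\<in>funcs S.
           prob_space (pmeas S n f) \<and>
           sets (pmeas S n f) = sets (sample S n) \<and>
           prob_space.indep_set (pmeas S n f)
             (sets (vimage_algebra (space (sample S n)) (X1 S n) (obs1 S n)))
             (sets (vimage_algebra (space (sample S n)) (X2 S n) (obs2 S n)))) \<and>
        grid S n \<subseteq> params S \<and> countable (grid S n) \<and>
        (\<forall>h\<in>params S.
           Ahat S n h \<in> obs1 S n \<rightarrow>\<^sub>M val1 S \<and>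
           (\<forall>\<eta>\<in>params S. Ahat2 S n h \<eta> \<in> obs1 S n \<rightarrow>\<^sub>M val1 S) \<and>
           Psi S n h \<in> borel_measurable (obs1 S n) \<and>
           (\<forall>x\<in>space (obs1 S n). 0 < Psi S n h x) \<and>
           Bhat S n h \<in> obs2 S n \<rightarrow>\<^sub>M val2 S \<and>
           (\<forall>f\<in>funcs S.
              Lam S n h f \<in> space (val1 S) \<and>
              (\<forall>\<eta>\<in>params S. Lam2 S n h \<eta> f \<in> space (val1 S)) \<and>
              Ups S n h f \<in> space (val2 S))) \<and>
        (\<forall>f\<in>funcs S.
           upper_dev S n f \<in> borel_measurable (obs1 S n) \<and>
           upper_dev2 S n f \<in> borel_measurable (obs1 S n) \<and>
           (\<forall>h\<in>grid S n.
              (\<lambda>y. rho S (Bhat S n h y) (Ups S n h f)) \<in> borel_measurable (obs2 S n))))"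

definition permutation_hyp where
  "permutation_hyp S \<longleftrightarrow>
     (\<forall>n\<ge>1. \<forall>h\<in>params S. \<forall>\<eta>\<in>params S. \<forall>x\<in>space (obs1 S n). Ahat2 S n h \<eta> x = Ahat2 S n \<eta> h x)"

definition upper_function_hyp where
  "upper_function_hyp S \<longleftrightarrow>
     (\<forall>n\<ge>1.
        (SUP f\<in>funcs S. \<integral>\<^sup>+ x. upper_dev S n f x \<partial>law1 S n f) \<le> ennreal (eps S n powr qexp S) \<and>
        (SUP f\<in>funcs S. \<integral>\<^sup>+ x. upper_dev2 S n f x \<partial>law1 S n f) \<le> ennreal (eps S n powr qexp S))"

definition psi where
  "psi S n f h = Lq_size (law1 S n f) (qexp S) (\<lambda>x. ennreal (Psi S n h x))"

definition concentration_hyp where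
  "concentration_hyp S C \<longleftrightarrow>
     (\<forall>n\<ge>1.
        (SUP f\<in>funcs S. \<integral>\<^sup>+ x. (SUP h\<in>grid S n.
            epowr (ennreal (Psi S n h x) - ennreal C * psi S n f h) (qexp S)) \<partial>law1 S n f)
          \<le> ennreal (eps S n powr qexp S) \<and>
        (SUP f\<in>funcs S. \<integral>\<^sup>+ x. (SUP h\<in>grid S n.
            epowr (psi S n f h - ennreal (C * Psi S n h x)) (qexp S)) \<partial>law1 S n f)
          \<le> ennreal (eps S n powr qexp S))"

definition bias where
  "bias S n f h =
     ennreal (ell S (Lam S n h f) (Amap S f)) +
     2 * (SUP \<eta>\<in>grid S n. ennreal (ell S (Lam2 S n h \<eta> f) (Lam S n \<eta> f)))"

definition err where
  "err S n f h =
     Lq_size (law2 S n f) (qexp S) (\<lambda>y. ennreal (rho S (Bhat S n h y) (Ups S n h f)))"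

definition Rhat where
  "Rhat S n h x =
     (SUP \<eta>\<in>grid S n. ennreal (max 0 (ell S (Ahat2 S n h \<eta> x) (Ahat S n \<eta> x) - 2 * Psi S n \<eta> x)))"

text \<open>A negative tolerance \<open>eps' n\<close> is truncated to \<open>0\<close> by \<^const>\<open>ennreal\<close>, which only
  admits more selectors \<open>hhat\<close>.\<close>

definition selection_rule where
  "selection_rule S eps' hhat \<longleftrightarrow>
     (\<forall>n\<ge>1.
        hhat n \<in> obs1 S n \<rightarrow>\<^sub>M count_space (grid S n) \<and>
        (\<forall>x\<in>space (obs1 S n).
           Rhat S n (hhat n x) x + 2 * ennreal (Psi S n (hhat n x) x)
             \<le> (INF h\<in>grid S n. Rhat S n h x + 2 * ennreal (Psi S n h x)) + ennreal (eps' n)))"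

definition delta where
  "delta S n = (INF f\<in>funcs S. INF h\<in>grid S n. psi S n f h)"

definition oracle_bound where
  "oracle_bound S n f = (INF \<eta>\<in>grid S n. bias S n f \<eta> + 2 * psi S n f \<eta>)"

definition VV where
  "VV S C n f = {h \<in> grid S n. psi S n f h < ennreal (2 * C\<^sup>2) * oracle_bound S n f}"

definition UU where
  "UU S C n f =
     {h \<in> grid S n. ennreal (ell S (Lam S n h f) (Amap S f)) < ennreal (4 * C) * oracle_bound S n f}"

definition tau where
  "tau S C n f =
     (SUP h\<in>VV S C n f. err S n f h)
     + (ennreal (5 * eps S n) / delta S n) * (SUP h\<in>grid S n. err S n f h)"

definition nu where
  "nu S C n f =
     (SUP h\<in>UU S C n f. ennreal (rho S (Ups S n h f) (Bmap S f)))
     + (ennreal (30 * eps S n) / delta S n)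
       * (SUP h\<in>grid S n. ennreal (rho S (Ups S n h f) (Bmap S f)))"

text \<open>\<open>Q\<close> is an estimator of \<open>Bmap S f\<close>, a function of both components of the observation.\<close>

definition risk_B where
  "risk_B S n Q f =
     Lq_size (pmeas S n f) (qexp S)
       (\<lambda>\<omega>. ennreal (rho S (Q (X1 S n \<omega>) (X2 S n \<omega>)) (Bmap S f)))"

end

theory Submission
  imports Defs
begin

text \<open>The selected index satisfies the oracle inequality up to the random errors \<open>z1\<close>, \<open>z2\<close>, \<open>c1\<close>, \<open>c2\<close>
  that the upper function and concentration hypotheses control in \<open>L\<^sup>q\<close>. If it lies outside \<^const>\<open>VV\<close>
  (or outside \<^const>\<open>UU\<close>), a fixed linear combination of these errors is at least
  \<^const>\<open>delta\<close>, so by Markov's inequality this has probability of order \<open>(eps / delta)\<^sup>q\<close>.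
  Since the selected index depends on \<open>X1\<close> only, independence replaces the loss of the selected
  estimator by \<^const>\<open>err\<close> at the selected index. Splitting according to the two exceptional events
  and applying Minkowski's inequality gives the bound.\<close>

section \<open>Powers of extended nonnegative reals and their convexity\<close>

lemma epowr_ennreal: "0 \<le> u \<Longrightarrow> epowr (ennreal u) r = ennreal (u powr r)"
  by (simp add: epowr_def)

lemma epowr_top [simp]: "epowr \<top> r = \<top>"
  by (simp add: epowr_def)

lemma epowr_0 [simp]: "epowr 0 r = 0"
  by (simp add: epowr_def)

lemma epowr_one [simp]: "epowr 1 r = 1"
  by (simp add: epowr_def)

lemma epowr_mono:
  assumes "x \<le> y" "0 \<le> r"
  shows "epowr x r \<le> epowr y r"
  using assms
  by (cases x rule: ennreal_cases; cases y rule: ennreal_cases)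
     (auto simp: epowr_ennreal powr_mono2 top_unique)

lemma epowr_mult:
  assumes "0 < r"
  shows "epowr (x * y) r = epowr x r * epowr y r"
proof (cases x rule: ennreal_cases)
  case (real u)
  show ?thesis
  proof (cases y rule: ennreal_cases)
    case r: (real v)
    show ?thesis
      using real r by (simp add: epowr_ennreal powr_mult flip: ennreal_mult)
  next
    case top
    then show ?thesis using real assms by (auto simp: ennreal_mult_top epowr_ennreal)
  qed
next
  case top
  have "epowr y r = 0 \<longleftrightarrow> y = 0"
    by (cases y rule: ennreal_cases) (auto simp: epowr_ennreal)
  then show ?thesis using top by (auto simp: ennreal_top_mult)
qed

lemma epowr_epowr: "epowr (epowr x r) s = epowr x (r * s)"
  by (cases x rule: ennreal_cases) (auto simp: epowr_ennreal powr_powr)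

lemma epowr_1 [simp]: "epowr x 1 = x"
  by (cases x rule: ennreal_cases) (auto simp: epowr_ennreal)

lemma measurable_epowr [measurable]: "(\<lambda>x. epowr x r) \<in> borel_measurable borel"
  unfolding epowr_def by measurable

text \<open>Convexity of \<open>t \<mapsto> t powr q\<close>, applied to the point of \<open>u / a\<close> and \<open>v / b\<close> that has
  weights proportional to \<open>a\<close> and \<open>b\<close>.\<close>

lemma powr_add_le:
  fixes u v a b q :: real
  assumes "0 \<le> u" "0 \<le> v" "0 < a" "0 < b" "1 \<le> q"
  shows "(u + v) powr q
    \<le> (a + b) powr q * (a / (a + b) * a powr (- q) * u powr q + b / (a + b) * b powr (- q) * v powr q)"
proof -
  define t where "t = b / (a + b)"
  have t: "0 \<le> t" "t \<le> 1" "1 - t = a / (a + b)"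
    using assms by (auto simp: t_def field_simps)
  \<comment> \<open>This settles convexity when one of the points is 0: only one term of the
    combination survives, and \<open>s powr q \<le> s\<close> on the unit interval.\<close>
  have shrink: "(s * y) powr q \<le> s * y powr q" if "0 \<le> s" "s \<le> 1" "0 \<le> y" for s y :: real
  proof -
    have "s powr q \<le> s powr 1"
      using that assms by (intro powr_mono') auto
    then show ?thesis using that by (simp add: powr_mult mult_right_mono)
  qed
  have conv: "((1 - t) * x + t * y) powr q \<le> (1 - t) * x powr q + t * y powr q"
    if "0 \<le> x" "0 \<le> y" for x y
  proof (cases "x = 0 \<or> y = 0")
    case True
    then show ?thesis using shrink[of t y] shrink[of "1 - t" x] t that by auto
  next
    case False
    then show ?thesis
      using convex_onD[OF powr_convex[OF assms(5)], of t x y] that t by simp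
  qed
  have "(a + b) * ((1 - t) * (u / a)) = u" "(a + b) * (t * (v / b)) = v"
    using assms unfolding t(3) by (auto simp: t_def)
  then have "u + v = (a + b) * ((1 - t) * (u / a) + t * (v / b))"
    by (simp only: distrib_left)
  then have "(u + v) powr q = (a + b) powr q * ((1 - t) * (u / a) + t * (v / b)) powr q"
    using assms t by (simp add: powr_mult)
  also have "\<dots> \<le> (a + b) powr q * ((1 - t) * (u / a) powr q + t * (v / b) powr q)"
    using assms by (intro mult_left_mono conv) auto
  finally show ?thesis
    using assms unfolding t(3) by (simp add: t_def powr_divide powr_minus_divide)
qed

text \<open>Extends the convexity bound to infinite arguments, where the positive coefficients make
  the right-hand side infinite as well.\<close>

lemma epowr_add_le:
  fixes a b q :: real
  assumes "0 < a" "0 < b" "1 \<le> q"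
  shows "epowr (x + y) q \<le> ennreal ((a + b) powr q * (a / (a + b) * a powr (- q))) * epowr x q
    + ennreal ((a + b) powr q * (b / (a + b) * b powr (- q))) * epowr y q"
proof (cases "x = \<top> \<or> y = \<top>")
  case True
  then show ?thesis using assms by (auto simp: ennreal_mult_top)
next
  case False
  then obtain u v where "x = ennreal u" "0 \<le> u" "y = ennreal v" "0 \<le> v"
    by (metis ennreal_cases)
  then show ?thesis
    using assms powr_add_le[of u v a b q]
    by (simp add: epowr_ennreal ring_distribs mult.assoc flip: ennreal_plus ennreal_mult)
qed

section \<open>\<open>Lq_size\<close> as an extended norm: Minkowski and Markov inequalities\<close>

lemma Lq_size_mono:
  assumes "1 \<le> q" "\<And>x. x \<in> space M \<Longrightarrow> g x \<le> h x"
  shows "Lq_size M q g \<le> Lq_size M q h"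
  unfolding Lq_size_def using assms by (intro epowr_mono nn_integral_mono) auto

lemma Lq_size_cmult:
  assumes "1 \<le> q" "g \<in> borel_measurable M"
  shows "Lq_size M q (\<lambda>x. c * g x) = c * Lq_size M q g"
proof -
  have "Lq_size M q (\<lambda>x. c * g x) = epowr (epowr c q * (\<integral>\<^sup>+ x. epowr (g x) q \<partial>M)) (1 / q)"
    unfolding Lq_size_def using assms by (simp add: epowr_mult nn_integral_cmult)
  also have "\<dots> = c * Lq_size M q g"
    unfolding Lq_size_def using assms by (simp add: epowr_mult epowr_epowr)
  finally show ?thesis .
qed

lemma Lq_size_indicator:
  assumes "1 \<le> q" "A \<in> sets M"
  shows "Lq_size M q (indicator A) = epowr (emeasure M A) (1 / q)"
proof -
  have "epowr (indicator A x) q = indicator A x" for x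
    by (simp add: indicator_def)
  then show ?thesis unfolding Lq_size_def using assms by simp
qed

lemma (in prob_space) Lq_size_const: "1 \<le> q \<Longrightarrow> Lq_size M q (\<lambda>_. c) = c"
  by (simp add: Lq_size_def epowr_epowr emeasure_space_1)

lemma Lq_size_distr:
  assumes "X \<in> M \<rightarrow>\<^sub>M N" "g \<in> borel_measurable N"
  shows "Lq_size (distr M N X) q g = Lq_size M q (\<lambda>\<omega>. g (X \<omega>))"
  unfolding Lq_size_def using assms by (simp add: nn_integral_distr)

lemma Lq_size_le_iff:
  assumes "1 \<le> q" "0 \<le> a"
  shows "Lq_size M q g \<le> ennreal a \<longleftrightarrow> (\<integral>\<^sup>+ x. epowr (g x) q \<partial>M) \<le> ennreal (a powr q)"
proof
  assume "Lq_size M q g \<le> ennreal a"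
  then have "epowr (Lq_size M q g) q \<le> epowr (ennreal a) q"
    using assms by (intro epowr_mono) auto
  then show "(\<integral>\<^sup>+ x. epowr (g x) q \<partial>M) \<le> ennreal (a powr q)"
    using assms by (simp add: Lq_size_def epowr_epowr epowr_ennreal)
next
  assume "(\<integral>\<^sup>+ x. epowr (g x) q \<partial>M) \<le> ennreal (a powr q)"
  then have "Lq_size M q g \<le> epowr (ennreal (a powr q)) (1 / q)"
    unfolding Lq_size_def using assms by (intro epowr_mono) auto
  then show "Lq_size M q g \<le> ennreal a"
    using assms by (simp add: epowr_ennreal powr_powr)
qed

text \<open>Minkowski's inequality. With \<open>a\<close> and \<open>b\<close> just above the two
  sizes, the \<open>q\<close>-th powers of \<open>g / a\<close> and \<open>h / b\<close> have
  integral at most 1, so integrating the weighted convexity bound gives a size of at most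
  \<open>a + b\<close>. The slack then tends to 0.\<close>

lemma Lq_size_add_le:
  assumes q: "1 \<le> q" and [measurable]: "g \<in> borel_measurable M" "h \<in> borel_measurable M"
  shows "Lq_size M q (\<lambda>x. g x + h x) \<le> Lq_size M q g + Lq_size M q h"
proof (rule ennreal_le_epsilon)
  fix e :: real
  assume fin: "Lq_size M q g + Lq_size M q h < \<top>" and "0 < e"
  then obtain u v where u: "Lq_size M q g = ennreal u" "0 \<le> u"
    and v: "Lq_size M q h = ennreal v" "0 \<le> v"
    by (metis ennreal_add_less_top ennreal_cases less_irrefl)
  \<comment> \<open>The slack \<open>e / 2\<close> keeps \<open>a\<close> and \<open>b\<close>
    positive, so that dividing by them is possible even when a size is 0.\<close>
  define a where "a = u + e / 2"
  define b where "b = v + e / 2"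
  have ab: "0 < a" "0 < b" and e: "a + b = u + v + e"
    using u v \<open>0 < e\<close> by (auto simp: a_def b_def)
  have ga: "(\<integral>\<^sup>+ x. epowr (g x) q \<partial>M) \<le> ennreal (a powr q)"
    using ab q u \<open>0 < e\<close> by (intro iffD1[OF Lq_size_le_iff]) (auto simp: a_def)
  have hb: "(\<integral>\<^sup>+ x. epowr (h x) q \<partial>M) \<le> ennreal (b powr q)"
    using ab q v \<open>0 < e\<close> by (intro iffD1[OF Lq_size_le_iff]) (auto simp: b_def)
  let ?s = "(a + b) powr q * (a / (a + b) * a powr (- q))"
  let ?t = "(a + b) powr q * (b / (a + b) * b powr (- q))"
  have "(\<integral>\<^sup>+ x. epowr (g x + h x) q \<partial>M)
      \<le> (\<integral>\<^sup>+ x. ennreal ?s * epowr (g x) q + ennreal ?t * epowr (h x) q \<partial>M)"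
    using ab q by (intro nn_integral_mono epowr_add_le)
  also have "\<dots> = ennreal ?s * (\<integral>\<^sup>+ x. epowr (g x) q \<partial>M) + ennreal ?t * (\<integral>\<^sup>+ x. epowr (h x) q \<partial>M)"
    by (simp add: nn_integral_add nn_integral_cmult)
  also have "\<dots> \<le> ennreal ?s * ennreal (a powr q) + ennreal ?t * ennreal (b powr q)"
    by (intro add_mono mult_left_mono ga hb) auto
  also have "\<dots> = ennreal (?s * a powr q + ?t * b powr q)"
    using ab by (simp flip: ennreal_plus ennreal_mult)
  also have "?s * a powr q + ?t * b powr q = (a + b) powr q * (a / (a + b) + b / (a + b))"
  proof -
    have "a powr (- q) * a powr q = 1" "b powr (- q) * b powr q = 1"
      using ab by (auto simp flip: powr_add)
    then show ?thesis by (simp add: distrib_left mult.assoc)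
  qed
  also have "\<dots> = (a + b) powr q"
    using ab by (simp flip: add_divide_distrib)
  finally have "Lq_size M q (\<lambda>x. g x + h x) \<le> ennreal (a + b)"
    using ab q by (intro iffD2[OF Lq_size_le_iff]) auto
  then show "Lq_size M q (\<lambda>x. g x + h x) \<le> Lq_size M q g + Lq_size M q h + ennreal e"
    using u v \<open>0 < e\<close> by (simp add: e)
qed

lemma Lq_size_add_le_add:
  assumes "1 \<le> q" "g \<in> borel_measurable M" "h \<in> borel_measurable M"
    and "Lq_size M q g \<le> a" "Lq_size M q h \<le> b"
  shows "Lq_size M q (\<lambda>x. g x + h x) \<le> a + b"
  using Lq_size_add_le[OF assms(1-3)] add_mono[OF assms(4,5)] by (rule order_trans)

text \<open>Compare \<open>Z\<close> with \<open>c * indicator A\<close>. Later \<open>c\<close> is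
  \<open>delta S n\<close>, the level that a combination of deviations reaches on an exceptional
  event.\<close>

lemma Lq_size_markov:
  assumes q: "1 \<le> q" and A: "A \<in> sets M"
    and dev: "\<And>x. x \<in> A \<Longrightarrow> c \<le> Z x"
    and Z: "Lq_size M q Z \<le> ennreal b" and c: "0 < c"
  shows "epowr (emeasure M A) (1 / q) \<le> ennreal b / c"
proof -
  let ?p = "epowr (emeasure M A) (1 / q)"
  have "c * ?p = Lq_size M q (\<lambda>x. c * indicator A x)"
    using q A by (simp add: Lq_size_cmult Lq_size_indicator)
  also have "\<dots> \<le> Lq_size M q Z"
    using q dev by (intro Lq_size_mono) (auto simp: indicator_def)
  finally have le: "c * ?p \<le> ennreal b"
    using Z by (rule order_trans)
  \<comment> \<open>\<open>c\<close> may be \<open>\<top>\<close>, where it cannot be cancelled; the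
    finite bound \<open>b\<close> then forces \<open>?p\<close> to vanish.\<close>
  show ?thesis
  proof (cases "c = \<top>")
    case True
    with le have "?p = 0"
      by (auto simp: ennreal_top_mult top_unique split: if_splits)
    then show ?thesis by simp
  next
    case False
    have "?p = c * ?p / c"
      using False c by (simp add: ennreal_mult_divide_eq mult.commute[of c])
    also have "\<dots> \<le> ennreal b / c"
      using le by (rule divide_right_mono_ennreal)
    finally show ?thesis .
  qed
qed

text \<open>Minkowski applied to the majorant \<open>s + t * indicator A\<close>; total mass 1 makes
  the constant contribute exactly \<open>s\<close>. In the application \<open>A\<close> is an
  exceptional event, \<open>s\<close> a supremum over the good indices and \<open>t\<close> the
  supremum over the whole grid.\<close>

lemma (in prob_space) Lq_size_two_level:
  assumes q: "1 \<le> q" and A: "A \<in> sets M"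
    and s: "\<And>x. x \<in> space M - A \<Longrightarrow> g x \<le> s" and t: "\<And>x. x \<in> A \<Longrightarrow> g x \<le> t"
    and p: "epowr (emeasure M A) (1 / q) \<le> p"
  shows "Lq_size M q g \<le> s + p * t"
proof -
  have "Lq_size M q g \<le> Lq_size M q (\<lambda>x. s + t * indicator A x)"
    using q s t by (intro Lq_size_mono) (auto simp: indicator_def intro: add_increasing)
  also have "\<dots> \<le> s + p * t"
  proof (rule Lq_size_add_le_add)
    have "Lq_size M q (\<lambda>x. t * indicator A x) = t * epowr (emeasure M A) (1 / q)"
      using q A by (simp add: Lq_size_cmult Lq_size_indicator)
    also have "\<dots> \<le> t * p"
      using p by (rule mult_left_mono) simp
    finally show "Lq_size M q (\<lambda>x. t * indicator A x) \<le> p * t"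
      by (simp add: mult.commute)
  qed (use q A in \<open>auto simp: Lq_size_const\<close>)
  finally show ?thesis .
qed

section \<open>Independence and random indices with countably many values\<close>

text \<open>The level sets of \<open>N\<close> form a countable partition, so integrals can be
  compared piece by piece. This reduces a random index to a fixed one.\<close>

lemma nn_integral_countable_partition:
  assumes I: "countable I" and N: "N \<in> M \<rightarrow>\<^sub>M count_space I"
    and F: "F \<in> borel_measurable M" and G: "G \<in> borel_measurable M"
    and eq: "\<And>h. h \<in> I \<Longrightarrow> (\<integral>\<^sup>+ \<omega>. F \<omega> * indicator {\<omega> \<in> space M. N \<omega> = h} \<omega> \<partial>M)
      = (\<integral>\<^sup>+ \<omega>. G \<omega> * indicator {\<omega> \<in> space M. N \<omega> = h} \<omega> \<partial>M)"
  shows "(\<integral>\<^sup>+ \<omega>. F \<omega> \<partial>M) = (\<integral>\<^sup>+ \<omega>. G \<omega> \<partial>M)"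
proof -
  \<comment> \<open>Codes turn the partition into a sequence. Since \<open>to_nat_on I\<close> is
    injective on the countable set \<open>I\<close>, each \<open>B i\<close> is a level set of
    \<open>N\<close>, or empty when \<open>i\<close> codes no index.\<close>
  define B where "B i = {\<omega> \<in> space M. to_nat_on I (N \<omega>) = i}" for i
  have NI: "N \<omega> \<in> I" if "\<omega> \<in> space M" for \<omega>
    using measurable_space[OF N that] by simp
  have "(\<lambda>\<omega>. to_nat_on I (N \<omega>)) \<in> M \<rightarrow>\<^sub>M count_space UNIV"
    using N by (rule measurable_compose) simp
  then have B: "B i \<in> sets M" for i
    unfolding B_def by measurable
  have split: "(\<integral>\<^sup>+ \<omega>. H \<omega> \<partial>M) = (\<Sum>i. \<integral>\<^sup>+ \<omega> \<in> B i. H \<omega> \<partial>M)"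
    if "H \<in> borel_measurable M" for H :: "_ \<Rightarrow> ennreal"
  proof -
    have "(\<Sum>i. \<integral>\<^sup>+ \<omega> \<in> B i. H \<omega> \<partial>M) = (\<integral>\<^sup>+ \<omega> \<in> (\<Union>i. B i). H \<omega> \<partial>M)"
      using that B by (intro nn_integral_disjoint_family[symmetric])
        (auto simp: disjoint_family_on_def B_def)
    also have "\<dots> = (\<integral>\<^sup>+ \<omega>. H \<omega> \<partial>M)"
      by (intro nn_integral_cong) (auto simp: B_def indicator_def)
    finally show ?thesis ..
  qed
  have "(\<integral>\<^sup>+ \<omega> \<in> B i. F \<omega> \<partial>M) = (\<integral>\<^sup>+ \<omega> \<in> B i. G \<omega> \<partial>M)" for i
  proof (cases "i \<in> to_nat_on I ` I")
    case True
    then obtain h where h: "h \<in> I" "i = to_nat_on I h" by auto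
    then have "B i = {\<omega> \<in> space M. N \<omega> = h}"
      using I NI by (auto simp: B_def)
    then show ?thesis using eq[OF h(1)] by simp
  next
    case False
    then have "B i = {}" using NI by (auto simp: B_def)
    then show ?thesis by simp
  qed
  then show ?thesis using F G by (simp add: split)
qed

text \<open>Restricting \<open>M\<close> to \<open>A\<close> and pushing forward along
  \<open>Y\<close> gives the law of \<open>Y\<close> scaled by the measure of \<open>A\<close>:
  independence yields this identity on every set of \<open>N\<close>, and equal measures have equal
  integrals.\<close>

lemma (in prob_space) nn_integral_mult_indicator_indep:
  assumes ind: "indep_set \<A> {Y -` B \<inter> space M | B. B \<in> sets N}"
    and A: "A \<in> \<A>" and Y: "Y \<in> M \<rightarrow>\<^sub>M N" and g: "g \<in> borel_measurable N"
  shows "(\<integral>\<^sup>+ \<omega>. g (Y \<omega>) * indicator A \<omega> \<partial>M) = emeasure M A * (\<integral>\<^sup>+ y. g y \<partial>distr M N Y)"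
proof -
  have AM: "A \<in> sets M"
    using indep_setD_ev1[OF ind] A by auto
  have "distr (density M (indicator A)) N Y = scale_measure (emeasure M A) (distr M N Y)"
  proof (rule measure_eqI)
    fix B assume "B \<in> sets (distr (density M (indicator A)) N Y)"
    then have B: "B \<in> sets N" by simp
    have YB: "Y -` B \<inter> space M \<in> sets M"
      using Y B by (rule measurable_sets)
    have "prob (A \<inter> (Y -` B \<inter> space M)) = prob A * prob (Y -` B \<inter> space M)"
      using ind A B by (intro indep_setD) auto
    then have "emeasure M (A \<inter> (Y -` B \<inter> space M)) = emeasure M A * emeasure M (Y -` B \<inter> space M)"
      by (simp add: emeasure_eq_measure ennreal_mult)
    moreover have "emeasure (density M (indicator A)) (Y -` B \<inter> space M)
        = emeasure M (A \<inter> (Y -` B \<inter> space M))"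
      using AM YB by (simp add: emeasure_density flip: indicator_inter_arith)
    ultimately show "emeasure (distr (density M (indicator A)) N Y) B
        = emeasure (scale_measure (emeasure M A) (distr M N Y)) B"
      using Y B by (simp add: emeasure_distr)
  qed simp
  moreover have "(\<integral>\<^sup>+ y. g y \<partial>distr (density M (indicator A)) N Y)
      = (\<integral>\<^sup>+ \<omega>. g (Y \<omega>) * indicator A \<omega> \<partial>M)"
    using AM Y g by (simp add: nn_integral_distr nn_integral_density mult.commute)
  ultimately show ?thesis
    using g by (simp add: nn_integral_scale_measure)
qed

text \<open>Conditionally on \<open>X\<close> the index \<open>N (X \<omega>)\<close> is frozen, so only the law of \<open>Y\<close> is integrated.\<close>

lemma (in prob_space) Lq_size_random_index:
  assumes ind: "indep_set {X -` A \<inter> space M | A. A \<in> sets K} {Y -` B \<inter> space M | B. B \<in> sets L}"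
    and X [measurable]: "X \<in> M \<rightarrow>\<^sub>M K" and Y [measurable]: "Y \<in> M \<rightarrow>\<^sub>M L"
    and I: "countable I" and N [measurable]: "N \<in> K \<rightarrow>\<^sub>M count_space I"
    and g [measurable]: "\<And>h. h \<in> I \<Longrightarrow> g h \<in> borel_measurable L"
    and q: "1 \<le> q"
  shows "Lq_size M q (\<lambda>\<omega>. g (N (X \<omega>)) (Y \<omega>))
    = Lq_size (distr M K X) q (\<lambda>x. Lq_size (distr M L Y) q (g (N x)))"
proof -
  let ?e = "\<lambda>h. Lq_size (distr M L Y) q (g h)"
  have NX: "(\<lambda>\<omega>. N (X \<omega>)) \<in> M \<rightarrow>\<^sub>M count_space I"
    by measurable
  have mg: "(\<lambda>\<omega>. g (N (X \<omega>)) (Y \<omega>)) \<in> borel_measurable M"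
    by (rule measurable_compose_countable'[OF _ NX I]) measurable
  have me: "(\<lambda>x. ?e (N x)) \<in> borel_measurable K"
    using N by (rule measurable_compose) simp
  have "(\<integral>\<^sup>+ \<omega>. epowr (g (N (X \<omega>)) (Y \<omega>)) q \<partial>M) = (\<integral>\<^sup>+ \<omega>. epowr (?e (N (X \<omega>))) q \<partial>M)"
  proof (rule nn_integral_countable_partition[OF I NX])
    fix h assume h: "h \<in> I"
    let ?A = "{\<omega> \<in> space M. N (X \<omega>) = h}"
    \<comment> \<open>Independence is stated for families of preimages, so the level set has to be
      exhibited as an event of \<open>X\<close>.\<close>
    have "?A = X -` (N -` {h} \<inter> space K) \<inter> space M"
      using measurable_space[OF X] by auto
    moreover have "N -` {h} \<inter> space K \<in> sets K"
      using h by (intro measurable_sets[OF N]) auto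
    ultimately have A: "?A \<in> {X -` A \<inter> space M | A. A \<in> sets K}" by blast
    then have AM: "?A \<in> sets M" using indep_setD_ev1[OF ind] by auto
    have "(\<integral>\<^sup>+ \<omega>. epowr (g (N (X \<omega>)) (Y \<omega>)) q * indicator ?A \<omega> \<partial>M)
        = (\<integral>\<^sup>+ \<omega>. epowr (g h (Y \<omega>)) q * indicator ?A \<omega> \<partial>M)"
      by (intro nn_integral_cong) (auto simp: indicator_def)
    also have "\<dots> = emeasure M ?A * (\<integral>\<^sup>+ y. epowr (g h y) q \<partial>distr M L Y)"
      by (intro nn_integral_mult_indicator_indep[OF ind A Y] measurable_compose[OF g[OF h]]) measurable
    also have "(\<integral>\<^sup>+ y. epowr (g h y) q \<partial>distr M L Y) = epowr (?e h) q"
      using q by (simp add: Lq_size_def epowr_epowr)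
    also have "emeasure M ?A * epowr (?e h) q = (\<integral>\<^sup>+ \<omega>. epowr (?e h) q * indicator ?A \<omega> \<partial>M)"
      using AM by (simp add: nn_integral_cmult mult.commute)
    also have "\<dots> = (\<integral>\<^sup>+ \<omega>. epowr (?e (N (X \<omega>))) q * indicator ?A \<omega> \<partial>M)"
      by (intro nn_integral_cong) (auto simp: indicator_def)
    finally show "(\<integral>\<^sup>+ \<omega>. epowr (g (N (X \<omega>)) (Y \<omega>)) q * indicator ?A \<omega> \<partial>M)
        = (\<integral>\<^sup>+ \<omega>. epowr (?e (N (X \<omega>))) q * indicator ?A \<omega> \<partial>M)" .
  qed (use mg me in measurable)
  then have "Lq_size M q (\<lambda>\<omega>. g (N (X \<omega>)) (Y \<omega>)) = Lq_size M q (\<lambda>\<omega>. ?e (N (X \<omega>)))"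
    by (simp add: Lq_size_def)
  also have "\<dots> = Lq_size (distr M K X) q (\<lambda>x. ?e (N x))"
    using Lq_size_distr[OF X me] by simp
  finally show ?thesis .
qed

section \<open>Pathwise bounds for the selected index\<close>

text \<open>Triangle inequality from \<open>Ahat2\<close> through \<open>Lam2\<close> and
  \<open>Lam\<close> to \<open>Ahat\<close>. The two stochastic pieces cost \<open>Psi\<close> at
  \<open>\<eta>\<close> each, which the \<open>2 * Psi\<close> subtracted in \<open>Rhat\<close>
  absorbs; the bias and the errors \<open>z1\<close>, \<open>z2\<close> remain.\<close>

lemma Rhat_le:
  assumes model: "is_selection_model S" and "n \<ge> 1" "f \<in> funcs S" "x \<in> space (obs1 S n)"
    and h: "h \<in> grid S n"
    and z1: "\<And>\<eta>. \<eta> \<in> grid S n \<Longrightarrow>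
      ennreal (ell S (Ahat S n \<eta> x) (Lam S n \<eta> f)) \<le> ennreal (Psi S n \<eta> x) + z1"
    and z2: "\<And>\<eta>. \<eta> \<in> grid S n \<Longrightarrow>
      ennreal (ell S (Ahat2 S n h \<eta> x) (Lam2 S n h \<eta> f)) \<le> ennreal (Psi S n \<eta> x) + z2"
  shows "Rhat S n h x \<le> (SUP \<eta>\<in>grid S n. ennreal (ell S (Lam2 S n h \<eta> f) (Lam S n \<eta> f))) + z1 + z2"
  unfolding Rhat_def
proof (rule SUP_least)
  fix \<eta> assume \<eta>: "\<eta> \<in> grid S n"
  let ?s = "SUP \<eta>\<in>grid S n. ennreal (ell S (Lam2 S n h \<eta> f) (Lam S n \<eta> f))"
  note model' = model[unfolded is_selection_model_def] assms(2-4)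
  have par: "h \<in> params S" "\<eta> \<in> params S"
    using model' h \<eta> by auto
  have sp: "Ahat2 S n h \<eta> x \<in> space (val1 S)" "Ahat S n \<eta> x \<in> space (val1 S)"
    "Lam2 S n h \<eta> f \<in> space (val1 S)" "Lam S n \<eta> f \<in> space (val1 S)"
    using model' par by (blast intro: measurable_space)+
  have sm: "semimetric_on (space (val1 S)) (ell S)"
    using model' by simp
  have pos: "0 < Psi S n \<eta> x"
    using model' par by simp
  let ?a = "ell S (Ahat2 S n h \<eta> x) (Lam2 S n h \<eta> f)"
  let ?b = "ell S (Lam2 S n h \<eta> f) (Lam S n \<eta> f)"
  let ?c = "ell S (Ahat S n \<eta> x) (Lam S n \<eta> f)"
  have tri: "ell S (Ahat2 S n h \<eta> x) (Ahat S n \<eta> x) \<le> ?a + ?b + ?c"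
    using sm sp unfolding semimetric_on_def by (smt (verit, best))
  have nn: "0 \<le> ?a" "0 \<le> ?b" "0 \<le> ?c"
    using sm sp unfolding semimetric_on_def by auto
  have "ennreal (?a + ?b + ?c) \<le> (ennreal (Psi S n \<eta> x) + z2) + ?s + (ennreal (Psi S n \<eta> x) + z1)"
    using nn \<eta> z1[OF \<eta>] z2[OF \<eta>] by (auto intro!: add_mono SUP_upper2[OF \<eta>])
  also have "\<dots> = ennreal (2 * Psi S n \<eta> x) + (?s + z1 + z2)"
    using pos by (simp add: ennreal_mult algebra_simps flip: mult_2)
  finally have "ennreal (ell S (Ahat2 S n h \<eta> x) (Ahat S n \<eta> x))
      \<le> ennreal (2 * Psi S n \<eta> x) + (?s + z1 + z2)"
    using tri by (meson ennreal_leI order_trans)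
  then have "ennreal (ell S (Ahat2 S n h \<eta> x) (Ahat S n \<eta> x)) - ennreal (2 * Psi S n \<eta> x) \<le> ?s + z1 + z2"
    by (simp add: ennreal_minus_le_iff)
  then show "ennreal (max 0 (ell S (Ahat2 S n h \<eta> x) (Ahat S n \<eta> x) - 2 * Psi S n \<eta> x)) \<le> ?s + z1 + z2"
    using pos by (simp add: ennreal_minus max_def ennreal_neg)
qed

lemma ell_Ahat2_le_Rhat:
  assumes "\<eta> \<in> grid S n" "0 < Psi S n \<eta> x"
  shows "ennreal (ell S (Ahat2 S n h \<eta> x) (Ahat S n \<eta> x)) \<le> Rhat S n h x + 2 * ennreal (Psi S n \<eta> x)"
proof -
  have "ennreal (ell S (Ahat2 S n h \<eta> x) (Ahat S n \<eta> x) - 2 * Psi S n \<eta> x) \<le> Rhat S n h x"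
    unfolding Rhat_def by (rule SUP_upper2[OF assms(1)]) simp
  then have "ennreal (ell S (Ahat2 S n h \<eta> x) (Ahat S n \<eta> x)) - ennreal (2 * Psi S n \<eta> x) \<le> Rhat S n h x"
    using assms(2) by (simp add: ennreal_minus)
  then show ?thesis
    using assms(2) by (simp add: ennreal_minus_le_iff ennreal_mult add.commute)
qed

text \<open>The path from \<open>Lam\<close> at \<open>g\<close> to \<open>Amap S f\<close> runs
  through \<open>Ahat\<close> at \<open>g\<close>, a two-index estimator, \<open>Ahat\<close> at
  \<open>h\<close> and \<open>Lam\<close> at \<open>h\<close>. By the permutation hypothesis the
  middle point is both \<open>Ahat2 S n h g x\<close> and \<open>Ahat2 S n g h x\<close>, so its
  distances to its neighbours are controlled by \<open>Rhat\<close> at \<open>h\<close> and at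
  \<open>g\<close>.\<close>

lemma selected_bounds:
  assumes model: "is_selection_model S" and perm: "permutation_hyp S"
    and nfx: "n \<ge> 1" "f \<in> funcs S" "x \<in> space (obs1 S n)"
    and g: "g \<in> grid S n" and h: "h \<in> grid S n"
    and sel: "Rhat S n g x + 2 * ennreal (Psi S n g x)
      \<le> Rhat S n h x + 2 * ennreal (Psi S n h x) + e"
    and z1: "\<And>\<eta>. \<eta> \<in> grid S n \<Longrightarrow>
      ennreal (ell S (Ahat S n \<eta> x) (Lam S n \<eta> f)) \<le> ennreal (Psi S n \<eta> x) + z1"
    and z2: "\<And>\<eta>. \<eta> \<in> grid S n \<Longrightarrow>
      ennreal (ell S (Ahat2 S n h \<eta> x) (Lam2 S n h \<eta> f)) \<le> ennreal (Psi S n \<eta> x) + z2"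
  defines "b \<equiv> SUP \<eta>\<in>grid S n. ennreal (ell S (Lam2 S n h \<eta> f) (Lam S n \<eta> f))"
  shows "2 * ennreal (Psi S n g x) \<le> b + z1 + z2 + 2 * ennreal (Psi S n h x) + e" (is ?Psi)
    and "2 * ennreal (ell S (Lam S n g f) (Amap S f))
      \<le> 2 * ennreal (ell S (Lam S n h f) (Amap S f))
        + 5 * b + 12 * ennreal (Psi S n h x) + 9 * z1 + 5 * z2 + 3 * e" (is ?Lam)
proof -
  note model' = model[unfolded is_selection_model_def] nfx
  have par: "h \<in> params S" "g \<in> params S"
    using model' g h by auto
  have sp: "Ahat2 S n g h x \<in> space (val1 S)" "Ahat S n g x \<in> space (val1 S)"
    "Ahat S n h x \<in> space (val1 S)" "Lam S n g f \<in> space (val1 S)"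
    "Lam S n h f \<in> space (val1 S)" "Amap S f \<in> space (val1 S)"
    using model' par by (blast intro: measurable_space)+
  have sm: "semimetric_on (space (val1 S)) (ell S)"
    using model' by simp
  have pos: "0 < Psi S n g x" "0 < Psi S n h x"
    using model' par by simp_all
  have swap: "Ahat2 S n g h x = Ahat2 S n h g x"
    using perm par nfx unfolding permutation_hyp_def by blast
  let ?m = "Rhat S n h x + 2 * ennreal (Psi S n h x)"
  let ?m' = "Rhat S n g x + 2 * ennreal (Psi S n g x)"
  have m: "?m \<le> b + z1 + z2 + 2 * ennreal (Psi S n h x)"
    unfolding b_def using Rhat_le[OF model nfx h z1 z2] by (rule add_right_mono)
  have Psig: "2 * ennreal (Psi S n g x) \<le> ?m + e"
    using sel by (rule order_trans[rotated]) (simp add: add_increasing)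
  also have "\<dots> \<le> b + z1 + z2 + 2 * ennreal (Psi S n h x) + e"
    using m by (rule add_right_mono)
  finally show ?Psi .
  let ?a = "ell S (Ahat S n g x) (Lam S n g f)"
  let ?b = "ell S (Ahat2 S n h g x) (Ahat S n g x)"
  let ?c = "ell S (Ahat2 S n g h x) (Ahat S n h x)"
  let ?d = "ell S (Ahat S n h x) (Lam S n h f)"
  let ?l = "ell S (Lam S n h f) (Amap S f)"
  have tri: "ell S (Lam S n g f) (Amap S f) \<le> ?a + ?b + ?c + ?d + ?l"
    using sm sp swap unfolding semimetric_on_def by (smt (verit, best))
  have nn: "0 \<le> ?a" "0 \<le> ?b" "0 \<le> ?c" "0 \<le> ?d" "0 \<le> ?l"
    using sm sp swap unfolding semimetric_on_def by auto
  have "ennreal (ell S (Lam S n g f) (Amap S f)) \<le> ennreal (?a + ?b + ?c + ?d + ?l)"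
    using tri by (rule ennreal_leI)
  also have "\<dots> = ennreal ?a + ennreal ?b + ennreal ?c + ennreal ?d + ennreal ?l"
    using nn by simp
  also have "\<dots> \<le> (ennreal (Psi S n g x) + z1) + (Rhat S n h x + 2 * ennreal (Psi S n g x))
      + (Rhat S n g x + 2 * ennreal (Psi S n h x)) + (ennreal (Psi S n h x) + z1) + ennreal ?l"
    using g h pos by (intro add_mono z1 ell_Ahat2_le_Rhat order_refl)
  \<comment> \<open>Doubling avoids halves: of the six copies of \<open>Psi\<close> at
    \<open>g\<close>, four combine with \<open>Rhat\<close> at \<open>g\<close> into
    \<open>2 * ?m'\<close>, and the other two are bounded by \<open>?m + e\<close>.\<close>
  finally have "2 * ennreal (ell S (Lam S n g f) (Amap S f))
      \<le> 2 * ((ennreal (Psi S n g x) + z1) + (Rhat S n h x + 2 * ennreal (Psi S n g x))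
      + (Rhat S n g x + 2 * ennreal (Psi S n h x)) + (ennreal (Psi S n h x) + z1) + ennreal ?l)"
    by (rule mult_left_mono) simp
  also have "\<dots> = 2 * ennreal (Psi S n g x) + 2 * ?m' + 2 * ?m
      + (4 * z1 + 2 * ennreal (Psi S n h x) + 2 * ennreal ?l)"
  proof -
    have "z1 * 4 = z1 * 2 + z1 * 2" by (simp flip: distrib_left)
    then show ?thesis by (simp add: algebra_simps)
  qed
  also have "\<dots> \<le> (?m + e) + 2 * (?m + e) + 2 * ?m
      + (4 * z1 + 2 * ennreal (Psi S n h x) + 2 * ennreal ?l)"
    by (intro add_right_mono add_mono[OF Psig mult_left_mono[OF sel]]) auto
  also have "\<dots> = 5 * ?m + (4 * z1 + 2 * ennreal (Psi S n h x) + 2 * ennreal ?l + 3 * e)"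
  proof -
    have five: "5 * ?m = ?m + 2 * ?m + 2 * ?m" and three: "3 * e = e + 2 * e"
      using distrib_right[of "1 + 2" 2 ?m] distrib_right[of 1 2 ?m] distrib_right[of 1 2 e] by simp_all
    show ?thesis unfolding five three distrib_left[of 2 ?m e] by (simp only: ac_simps)
  qed
  also have "\<dots> \<le> 5 * (b + z1 + z2 + 2 * ennreal (Psi S n h x))
      + (4 * z1 + 2 * ennreal (Psi S n h x) + 2 * ennreal ?l + 3 * e)"
    by (rule add_right_mono[OF mult_left_mono[OF m]]) simp
  \<comment> \<open>\<open>5 * ?m\<close> contributes 5 copies of \<open>z1\<close> and 10 of
    \<open>Psi\<close> at \<open>h\<close>; the 4 and 2 already present make 9 and 12.\<close>
  also have "\<dots> = 2 * ennreal ?l + 5 * b + 12 * ennreal (Psi S n h x) + 9 * z1 + 5 * z2 + 3 * e"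
  proof -
    have "z1 * 9 = z1 * 4 + z1 * 5"
      and "12 * ennreal (Psi S n h x) = 2 * ennreal (Psi S n h x) + 10 * ennreal (Psi S n h x)"
      by (simp_all flip: distrib_left distrib_right)
    then show ?thesis by (simp add: algebra_simps)
  qed
  finally show ?Lam .
qed

text \<open>Below, \<open>r\<close> is the oracle bound, \<open>a\<close>, \<open>\<beta>\<close>, \<open>p\<close> describe a near-minimiser of it, and \<open>Pg\<close>, \<open>pg\<close>,
  \<open>ag\<close> the selected index.\<close>

lemma deviation_of_large_psi:
  fixes C r a \<beta> p :: real
  assumes C: "1 \<le> C" and nn: "0 \<le> a" "0 \<le> \<beta>" "0 \<le> p" "0 \<le> c2" and r: "0 < r"
    and near: "a + 2 * \<beta> + 2 * p \<le> 9 / 8 * r"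
    and large: "2 * C\<^sup>2 * r \<le> pg" and pg: "pg \<le> C * Pg + c2"
    and Pg: "2 * Pg \<le> \<beta> + z1 + z2 + 2 * Ph + e" and Ph: "Ph \<le> C * p + c1" and e: "8 * e \<le> r"
  shows "11 * r \<le> 4 * z1 + 4 * z2 + 8 * c1 + 8 * c2"
proof -
  have C1: "\<beta> \<le> C * \<beta>" "c2 \<le> C * c2" "r \<le> C * r"
    using C nn r mult_right_mono[of 1 C] by auto
  have "C * (\<beta> + 2 * p) \<le> C * (9 / 8 * r)"
    using near nn C by (intro mult_left_mono) auto
  then have "2 * Pg \<le> 9 / 8 * (C * r) + z1 + z2 + 2 * c1 + r / 8"
    using Pg Ph e C1 by (simp add: algebra_simps)
  \<comment> \<open>The threshold carries \<open>C\<^sup>2\<close> because one factor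
    \<open>C\<close> is lost in passing from \<open>pg\<close> to \<open>Pg\<close> and another in
    bounding \<open>Ph\<close> by \<open>p\<close>. The first is cancelled here, after enlarging
    \<open>c2\<close> to \<open>C * c2\<close>.\<close>
  moreover have "C * (4 * (C * r)) \<le> C * (2 * Pg + 2 * c2)"
    using large pg C1 by (simp add: power2_eq_square algebra_simps)
  then have "4 * (C * r) \<le> 2 * Pg + 2 * c2"
    using C by simp
  ultimately show ?thesis using C1 by (simp add: algebra_simps)
qed

text \<open>Doubling \<open>large\<close> gives \<open>8 * C * r\<close>. The near-minimiser
  accounts for at most \<open>27 / 4 * C * r\<close> and the tolerance for \<open>3 / 8 * r\<close>;
  at least \<open>7 / 8 * r\<close> must come from the deviations.\<close>

lemma deviation_of_large_bias:
  fixes C r a \<beta> p :: real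
  assumes C: "1 \<le> C" and nn: "0 \<le> a" "0 \<le> \<beta>" "0 \<le> p" and r: "0 < r"
    and near: "a + 2 * \<beta> + 2 * p \<le> 9 / 8 * r"
    and large: "4 * C * r \<le> ag"
    and ag: "2 * ag \<le> 2 * a + 5 * \<beta> + 12 * Ph + 9 * z1 + 5 * z2 + 3 * e"
    and Ph: "Ph \<le> C * p + c1" and e: "8 * e \<le> r"
  shows "7 * r \<le> 8 * (9 * z1 + 5 * z2 + 12 * c1)"
proof -
  have C1: "a \<le> C * a" "\<beta> \<le> C * \<beta>" "r \<le> C * r"
    using C nn r mult_right_mono[of 1 C] by auto
  \<comment> \<open>The factor \<open>6 * C\<close> is dictated by \<open>12 * Ph\<close>: it
    produces \<open>12 * C * p\<close>, and its other terms dominate \<open>2 * a\<close> and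
    \<open>5 * \<beta>\<close>.\<close>
  have "6 * C * (a + 2 * \<beta> + 2 * p) \<le> 6 * C * (9 / 8 * r)"
    using near C by (intro mult_left_mono) auto
  then have "6 * (C * a) + 12 * (C * \<beta>) + 12 * (C * p) \<le> 27 / 4 * (C * r)"
    by (simp add: algebra_simps)
  then have "2 * ag \<le> 27 / 4 * (C * r) + 12 * c1 + 9 * z1 + 5 * z2 + 3 / 8 * r"
    using ag Ph e C1 nn by (simp add: algebra_simps)
  then show ?thesis using large C1 by (simp add: algebra_simps)
qed

text \<open>An infinite deviation makes the claim trivial; otherwise the relevant quantities are
  finite and the two real estimates apply. These bound multiples of the oracle bound
  \<open>r\<close>, and \<open>2 * d \<le> r\<close> turns them into bounds on
  \<open>delta S n\<close>.\<close>

lemma selected_deviation: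
  assumes model: "is_selection_model S" and perm: "permutation_hyp S"
    and nfx: "n \<ge> 1" "f \<in> funcs S" "x \<in> space (obs1 S n)" and C: "1 \<le> C"
    and g: "g \<in> grid S n"
    and sel: "Rhat S n g x + 2 * ennreal (Psi S n g x)
      \<le> (INF h\<in>grid S n. Rhat S n h x + 2 * ennreal (Psi S n h x)) + e"
    and e: "e \<le> delta S n / 4" and delta: "0 < delta S n"
    and z1: "\<And>h. h \<in> grid S n \<Longrightarrow>
      ennreal (ell S (Ahat S n h x) (Lam S n h f)) \<le> ennreal (Psi S n h x) + z1"
    and z2: "\<And>h \<eta>. h \<in> grid S n \<Longrightarrow> \<eta> \<in> grid S n \<Longrightarrow>
      ennreal (ell S (Ahat2 S n h \<eta> x) (Lam2 S n h \<eta> f)) \<le> ennreal (Psi S n \<eta> x) + z2"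
    and c1: "\<And>h. h \<in> grid S n \<Longrightarrow> ennreal (Psi S n h x) \<le> ennreal C * psi S n f h + c1"
    and c2: "\<And>h. h \<in> grid S n \<Longrightarrow> psi S n f h \<le> ennreal (C * Psi S n h x) + c2"
  shows "g \<notin> VV S C n f \<Longrightarrow> delta S n \<le> z1 + z2 + c1 + c2"
    and "g \<notin> UU S C n f \<Longrightarrow> delta S n \<le> 9 * z1 + 5 * z2 + 12 * c1 + c2"
proof -
  \<comment> \<open>The second sum contains \<open>c2\<close> for the sake of this case: an infinite
    \<open>c2\<close> gives no control of \<open>psi\<close>.\<close>
  have fin: "delta S n \<le> 9 * z1 + 5 * z2 + 12 * c1 + c2 \<and> delta S n \<le> z1 + z2 + c1 + c2"
    if "z1 = \<top> \<or> z2 = \<top> \<or> c1 = \<top> \<or> c2 = \<top>"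
    using that by (auto simp: ennreal_mult_top)
  have main: "(g \<notin> VV S C n f \<longrightarrow> delta S n \<le> z1 + z2 + c1 + c2)
      \<and> (g \<notin> UU S C n f \<longrightarrow> delta S n \<le> 9 * z1 + 5 * z2 + 12 * c1 + c2)"
    if finite: "z1 \<noteq> \<top>" "z2 \<noteq> \<top>" "c1 \<noteq> \<top>" "c2 \<noteq> \<top>"
      and outside: "g \<notin> VV S C n f \<or> g \<notin> UU S C n f"
  proof -
    obtain u1 u2 v1 v2 where z: "z1 = ennreal u1" "0 \<le> u1" "z2 = ennreal u2" "0 \<le> u2"
      "c1 = ennreal v1" "0 \<le> v1" "c2 = ennreal v2" "0 \<le> v2"
      using finite by (metis ennreal_cases)
    have psi_fin: "psi S n f h \<noteq> \<top>" if "h \<in> grid S n" for h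
      using c2[OF that] z by (auto simp: top_unique)
    \<comment> \<open>An infinite oracle bound would make both thresholds infinite; the finite
      values at \<open>g\<close> would lie strictly below them, against
      \<open>outside\<close>.\<close>
    have oracle_fin: "oracle_bound S n f \<noteq> \<top>"
      using outside psi_fin[OF g] g C by (auto simp: VV_def UU_def ennreal_mult_top not_less top_unique)
    then obtain r where r: "oracle_bound S n f = ennreal r" "0 \<le> r"
      by (metis ennreal_cases)
    have delta_le: "delta S n \<le> psi S n f h" if "h \<in> grid S n" for h
      unfolding delta_def using nfx that by (auto intro!: INF_lower2[of f] INF_lower)
    \<comment> \<open>\<open>psi\<close> is at least \<open>delta\<close> and enters the oracle
      bound twice. Hence \<open>r\<close> is positive, and a tolerance of at most
      \<open>d / 4\<close> is at most \<open>r / 8\<close>.\<close>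
    have "2 * delta S n \<le> oracle_bound S n f"
      unfolding oracle_bound_def
      by (intro INF_greatest add_increasing mult_left_mono delta_le) auto
    moreover have "delta S n \<noteq> \<top>"
      using delta_le[OF g] psi_fin[OF g] by (auto simp: top_unique)
    then obtain d where d: "delta S n = ennreal d" "0 \<le> d"
      by (metis ennreal_cases)
    ultimately have dr: "2 * d \<le> r"
      using r by (simp flip: ennreal_mult ennreal_numeral)
    have d0: "0 < d" using delta d by simp
    obtain e' where e': "e = ennreal e'" "0 \<le> e'" "4 * e' \<le> d"
    proof -
      have le: "e \<le> ennreal (d / 4)"
        using e d by (simp add: ennreal_divide_numeral)
      then obtain e' where "e = ennreal e'" "0 \<le> e'"
        by (cases e rule: ennreal_cases) (auto simp: top_unique)
      then show ?thesis using that[of e'] le d by auto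
    qed
    \<comment> \<open>The infimum need not be attained; since \<open>r\<close> is positive, the
      factor \<open>9 / 8\<close> leaves room for a near-minimiser \<open>h\<close>.\<close>
    have "oracle_bound S n f < ennreal (9 / 8 * r)"
      using r dr d0 by (simp add: ennreal_less_iff)
    then obtain h where h: "h \<in> grid S n" and near: "bias S n f h + 2 * psi S n f h < ennreal (9 / 8 * r)"
      unfolding oracle_bound_def by (auto simp: INF_less_iff)
    let ?a = "ell S (Lam S n h f) (Amap S f)"
    define b where "b = (SUP \<eta>\<in>grid S n. ennreal (ell S (Lam2 S n h \<eta> f) (Lam S n \<eta> f)))"
    have near': "ennreal ?a + 2 * b + 2 * psi S n f h < ennreal (9 / 8 * r)"
      using near by (simp add: bias_def b_def)
    then have "b \<noteq> \<top>"
      by (auto simp: ennreal_mult_top)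
    then obtain \<beta> where \<beta>: "b = ennreal \<beta>" "0 \<le> \<beta>"
      by (metis ennreal_cases)
    obtain p where p: "psi S n f h = ennreal p" "0 \<le> p"
      using psi_fin[OF h] by (metis ennreal_cases)
    obtain pg where pg: "psi S n f g = ennreal pg" "0 \<le> pg"
      using psi_fin[OF g] by (metis ennreal_cases)
    note model' = model[unfolded is_selection_model_def] nfx
    have par: "h \<in> params S" "g \<in> params S"
      using model' g h by auto
    have pos: "0 < Psi S n g x" "0 < Psi S n h x"
      using model' par by simp_all
    have sp: "Lam S n g f \<in> space (val1 S)" "Lam S n h f \<in> space (val1 S)" "Amap S f \<in> space (val1 S)"
      using model' par by (blast intro: measurable_space)+
    have a0: "0 \<le> ?a" "0 \<le> ell S (Lam S n g f) (Amap S f)"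
      using model' sp by (auto simp: semimetric_on_def)
    have near_real: "?a + 2 * \<beta> + 2 * p \<le> 9 / 8 * r"
      using near' a0 \<beta> p r by (simp flip: ennreal_plus ennreal_mult ennreal_numeral add: ennreal_less_iff)
    have selh: "Rhat S n g x + 2 * ennreal (Psi S n g x)
        \<le> Rhat S n h x + 2 * ennreal (Psi S n h x) + ennreal e'"
      using sel unfolding e'(1) by (rule order_trans) (intro add_right_mono INF_lower h)
    note bounds = selected_bounds[OF model perm nfx g h selh z1 z2[OF h], folded b_def]
    have Pg: "2 * Psi S n g x \<le> \<beta> + u1 + u2 + 2 * Psi S n h x + e'"
      using bounds(1) pos z e' \<beta> by (simp flip: ennreal_plus ennreal_mult ennreal_numeral)
    have ag: "2 * ell S (Lam S n g f) (Amap S f)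
        \<le> 2 * ?a + 5 * \<beta> + 12 * Psi S n h x + 9 * u1 + 5 * u2 + 3 * e'"
      using bounds(2) a0 pos z e' \<beta> by (simp flip: ennreal_plus ennreal_mult ennreal_numeral)
    have Ph: "Psi S n h x \<le> C * p + v1"
      using c1[OF h] C p z by (simp flip: ennreal_plus ennreal_mult)
    have pgle: "pg \<le> C * Psi S n g x + v2"
      using c2[OF g] C pg pos z by (simp flip: ennreal_plus)
    have r0: "0 < r" "8 * e' \<le> r" using dr d0 e' by auto
    show ?thesis
    proof (intro conjI impI)
      assume "g \<notin> VV S C n f"
      then have "2 * C\<^sup>2 * r \<le> pg"
        using g r pg by (simp add: VV_def not_less flip: ennreal_mult)
      from deviation_of_large_psi[OF C a0(1) \<beta>(2) p(2) z(8) r0(1) near_real this pgle Pg Ph r0(2)]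
      have "d \<le> u1 + u2 + v1 + v2" using dr z by linarith
      then show "delta S n \<le> z1 + z2 + c1 + c2"
        using z d by (simp flip: ennreal_plus)
    next
      assume "g \<notin> UU S C n f"
      then have "4 * C * r \<le> ell S (Lam S n g f) (Amap S f)"
        using g r a0 C by (simp add: UU_def not_less flip: ennreal_mult)
      from deviation_of_large_bias[OF C a0(1) \<beta>(2) p(2) r0(1) near_real this ag Ph r0(2)]
      have "d \<le> 9 * u1 + 5 * u2 + 12 * v1 + v2" using dr z(2,4,6,8) by (simp add: algebra_simps)
      then show "delta S n \<le> 9 * z1 + 5 * z2 + 12 * c1 + c2"
        using z d by (simp flip: ennreal_plus ennreal_mult ennreal_numeral)
    qed
  qed
  show "g \<notin> VV S C n f \<Longrightarrow> delta S n \<le> z1 + z2 + c1 + c2"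
    and "g \<notin> UU S C n f \<Longrightarrow> delta S n \<le> 9 * z1 + 5 * z2 + 12 * c1 + c2"
    using fin main by blast+
qed

section \<open>Probabilities of the exceptional events\<close>

lemma le_epowr_SUP:
  assumes "h \<in> A" "1 \<le> q"
  shows "F h \<le> epowr (SUP h\<in>A. epowr (F h) q) (1 / q)"
proof -
  have "epowr (epowr (F h) q) (1 / q) \<le> epowr (SUP h\<in>A. epowr (F h) q) (1 / q)"
    using assms by (intro epowr_mono SUP_upper) auto
  then show ?thesis using assms by (simp add: epowr_epowr)
qed

lemma Lq_size_epowr_le:
  assumes "1 \<le> q" "0 \<le> a" "(\<integral>\<^sup>+ x. u x \<partial>M) \<le> ennreal (a powr q)"
  shows "Lq_size M q (\<lambda>x. epowr (u x) (1 / q)) \<le> ennreal a"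
  using assms by (simp add: Lq_size_le_iff epowr_epowr)

lemma Lq_size_cmult_le:
  assumes "1 \<le> q" "g \<in> borel_measurable M" "Lq_size M q g \<le> a"
  shows "Lq_size M q (\<lambda>x. c * g x) \<le> c * a"
  using assms by (simp add: Lq_size_cmult mult_left_mono)

lemma le_add_of_max_diff:
  assumes "0 < b" "ennreal (max 0 (a - b)) \<le> c"
  shows "ennreal a \<le> ennreal b + c"
proof -
  have "ennreal a - ennreal b \<le> c"
    using assms by (simp add: ennreal_minus max_def ennreal_neg split: if_splits)
  then show ?thesis by (simp add: ennreal_minus_le_iff)
qed

text \<open>Every subset of \<open>I\<close> is measurable in \<open>count_space I\<close>, so this
  covers the events of leaving \<open>VV\<close> and \<open>UU\<close>.\<close>

lemma sets_index_notin:
  assumes "N \<in> M \<rightarrow>\<^sub>M count_space I"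
  shows "{x \<in> space M. N x \<notin> T} \<in> sets M"
proof -
  have "N -` (I - T) \<inter> space M \<in> sets M"
    by (intro measurable_sets[OF assms]) auto
  moreover have "N -` (I - T) \<inter> space M = {x \<in> space M. N x \<notin> T}"
    using measurable_space[OF assms] by auto
  ultimately show ?thesis by simp
qed

text \<open>The hypotheses bound integrals of suprema of \<open>q\<close>-th powers. The roots
  \<open>z1\<close>, \<open>z2\<close>, \<open>c1\<close>, \<open>c2\<close> of these suprema
  dominate the deviations at all grid indices at once and have size at most \<open>eps S n\<close>.
  Minkowski bounds the combinations from \<open>selected_deviation\<close>, and Markov is applied at
  level \<open>delta S n\<close>.\<close>

lemma selection_probabilities:
  assumes model: "is_selection_model S" and perm: "permutation_hyp S"
    and upper: "upper_function_hyp S"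
    and C: "1 \<le> C" and conc: "concentration_hyp S C"
    and delta: "0 < delta S n"
    and rule: "selection_rule S eps' hhat"
    and tol: "ennreal (eps' n) \<le> delta S n / 4"
    and n: "n \<ge> 1" and f: "f \<in> funcs S"
  shows "epowr (emeasure (law1 S n f) {x \<in> space (obs1 S n). hhat n x \<notin> VV S C n f}) (1 / qexp S)
      \<le> ennreal (5 * eps S n) / delta S n" (is ?V)
    and "epowr (emeasure (law1 S n f) {x \<in> space (obs1 S n). hhat n x \<notin> UU S C n f}) (1 / qexp S)
      \<le> ennreal (30 * eps S n) / delta S n" (is ?U)
proof -
  let ?q = "qexp S" and ?L = "law1 S n f" and ?O = "obs1 S n" and ?H = "grid S n"
  note model' = model[unfolded is_selection_model_def] n f
  have q: "1 \<le> ?q" and eps: "0 \<le> eps S n" and cnt: "countable ?H"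
    using model' by auto
  have sets [measurable_cong, simp]: "sets ?L = sets ?O" and space [simp]: "space ?L = space ?O"
    by (simp_all add: law1_def)
  have par: "h \<in> params S" if "h \<in> ?H" for h
    using model' that by auto
  have pos: "0 < Psi S n h x" if "h \<in> ?H" "x \<in> space ?O" for h x
    using model' par[OF that(1)] that(2) by simp
  have mPsi: "Psi S n h \<in> borel_measurable ?O" if "h \<in> ?H" for h
    using model' par[OF that] by simp
  have hhat [measurable]: "hhat n \<in> ?O \<rightarrow>\<^sub>M count_space ?H"
    using rule n by (simp add: selection_rule_def)
  define w1 where "w1 x = (SUP h\<in>?H. epowr (ennreal (Psi S n h x) - ennreal C * psi S n f h) ?q)" for x
  define w2 where "w2 x = (SUP h\<in>?H. epowr (psi S n f h - ennreal (C * Psi S n h x)) ?q)" for x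
  define z1 where "z1 x = epowr (upper_dev S n f x) (1 / ?q)" for x
  define z2 where "z2 x = epowr (upper_dev2 S n f x) (1 / ?q)" for x
  define c1 where "c1 x = epowr (w1 x) (1 / ?q)" for x
  define c2 where "c2 x = epowr (w2 x) (1 / ?q)" for x
  have m1: "w1 \<in> borel_measurable ?O"
    unfolding w1_def[abs_def] by (intro borel_measurable_SUP[OF cnt] measurable_compose[OF _ measurable_epowr]
      borel_measurable_minus_ennreal measurable_compose[OF mPsi measurable_ennreal]) auto
  have m2: "w2 \<in> borel_measurable ?O"
    unfolding w2_def[abs_def] by (intro borel_measurable_SUP[OF cnt] measurable_compose[OF _ measurable_epowr]
      borel_measurable_minus_ennreal measurable_compose[OF borel_measurable_times[OF _ mPsi] measurable_ennreal]) auto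
  have mz [measurable]: "z1 \<in> borel_measurable ?O" "z2 \<in> borel_measurable ?O"
    "c1 \<in> borel_measurable ?O" "c2 \<in> borel_measurable ?O"
    unfolding z1_def[abs_def] z2_def[abs_def] c1_def[abs_def] c2_def[abs_def]
    using model' m1 m2 by (auto intro!: measurable_compose[OF _ measurable_epowr])
  have "(\<integral>\<^sup>+ x. upper_dev S n f x \<partial>?L) \<le> ennreal (eps S n powr ?q)"
    and "(\<integral>\<^sup>+ x. upper_dev2 S n f x \<partial>?L) \<le> ennreal (eps S n powr ?q)"
    using upper n f unfolding upper_function_hyp_def by (auto simp: SUP_le_iff)
  moreover have "(\<integral>\<^sup>+ x. w1 x \<partial>?L) \<le> ennreal (eps S n powr ?q)"
    and "(\<integral>\<^sup>+ x. w2 x \<partial>?L) \<le> ennreal (eps S n powr ?q)"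
    using conc n f unfolding concentration_hyp_def w1_def w2_def by (auto simp: SUP_le_iff)
  ultimately have Lz: "Lq_size ?L ?q z1 \<le> ennreal (eps S n)" "Lq_size ?L ?q z2 \<le> ennreal (eps S n)"
    "Lq_size ?L ?q c1 \<le> ennreal (eps S n)" "Lq_size ?L ?q c2 \<le> ennreal (eps S n)"
    unfolding z1_def[abs_def] z2_def[abs_def] c1_def[abs_def] c2_def[abs_def]
    using q eps by (auto intro: Lq_size_epowr_le)
  have dev: "(hhat n x \<notin> VV S C n f \<longrightarrow> delta S n \<le> z1 x + z2 x + c1 x + c2 x)
      \<and> (hhat n x \<notin> UU S C n f \<longrightarrow> delta S n \<le> 9 * z1 x + 5 * z2 x + 12 * c1 x + c2 x)"
    if x: "x \<in> space ?O" for x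
  proof -
    have g: "hhat n x \<in> ?H"
      using measurable_space[OF hhat x] by simp
    have sel: "Rhat S n (hhat n x) x + 2 * ennreal (Psi S n (hhat n x) x)
        \<le> (INF h\<in>?H. Rhat S n h x + 2 * ennreal (Psi S n h x)) + ennreal (eps' n)"
      using rule n x by (simp add: selection_rule_def)
    have 1: "ennreal (ell S (Ahat S n h x) (Lam S n h f)) \<le> ennreal (Psi S n h x) + z1 x"
      if h: "h \<in> ?H" for h
    proof (rule le_add_of_max_diff[OF pos[OF h x]])
      show "ennreal (max 0 (ell S (Ahat S n h x) (Lam S n h f) - Psi S n h x)) \<le> z1 x"
        unfolding z1_def upper_dev_def by (rule le_epowr_SUP[OF h q])
    qed
    have 2: "ennreal (ell S (Ahat2 S n h \<eta> x) (Lam2 S n h \<eta> f)) \<le> ennreal (Psi S n \<eta> x) + z2 x"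
      if h: "h \<in> ?H" and \<eta>: "\<eta> \<in> ?H" for h \<eta>
    proof (rule le_add_of_max_diff[OF pos[OF \<eta> x]])
      let ?D = "\<lambda>h \<eta>. ennreal (max 0 (ell S (Ahat2 S n h \<eta> x) (Lam2 S n h \<eta> f) - min (Psi S n h x) (Psi S n \<eta> x)))"
      \<comment> \<open>The minimum is at most \<open>Psi S n \<eta> x\<close>, so subtracting the
        latter leaves a smaller positive part.\<close>
      have "ennreal (max 0 (ell S (Ahat2 S n h \<eta> x) (Lam2 S n h \<eta> f) - Psi S n \<eta> x)) \<le> ?D h \<eta>"
        by (intro ennreal_leI) auto
      also have "\<dots> \<le> epowr (SUP \<eta>\<in>?H. epowr (?D h \<eta>) ?q) (1 / ?q)"
        using \<eta> q by (rule le_epowr_SUP)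
      also have "\<dots> \<le> z2 x"
        unfolding z2_def upper_dev2_def using q h
        by (intro epowr_mono SUP_upper2[where f = "\<lambda>h. SUP \<eta>\<in>?H. epowr (?D h \<eta>) ?q", OF h]) auto
      finally show "ennreal (max 0 (ell S (Ahat2 S n h \<eta> x) (Lam2 S n h \<eta> f) - Psi S n \<eta> x)) \<le> z2 x" .
    qed
    have 3: "ennreal (Psi S n h x) \<le> ennreal C * psi S n f h + c1 x" if h: "h \<in> ?H" for h
    proof -
      have "ennreal (Psi S n h x) - ennreal C * psi S n f h \<le> c1 x"
        unfolding c1_def w1_def by (rule le_epowr_SUP[OF h q])
      then show ?thesis by (simp add: ennreal_minus_le_iff)
    qed
    have 4: "psi S n f h \<le> ennreal (C * Psi S n h x) + c2 x" if h: "h \<in> ?H" for h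
    proof -
      have "psi S n f h - ennreal (C * Psi S n h x) \<le> c2 x"
        unfolding c2_def w2_def by (rule le_epowr_SUP[OF h q])
      then show ?thesis by (simp add: ennreal_minus_le_iff)
    qed
    note D = selected_deviation[OF model perm n f x C g sel tol delta 1 2 3 4]
    show ?thesis using D by blast
  qed
  have mset: "{x \<in> space ?O. hhat n x \<notin> T} \<in> sets ?L" for T
    using sets_index_notin[OF hhat] by simp
  have "Lq_size ?L ?q (\<lambda>x. z1 x + z2 x + c1 x + c2 x)
      \<le> ennreal (eps S n) + ennreal (eps S n) + ennreal (eps S n) + ennreal (eps S n)"
    by (intro Lq_size_add_le_add q Lz) measurable
  \<comment> \<open>Four deviations of size \<open>eps S n\<close>, rounded up to the constant 5 in
    \<open>tau\<close>.\<close>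
  also have "\<dots> \<le> ennreal (5 * eps S n)"
    using eps by (simp flip: ennreal_plus)
  finally show ?V
    using dev delta by (intro Lq_size_markov[OF q mset]) auto
  have "Lq_size ?L ?q (\<lambda>x. 9 * z1 x + 5 * z2 x + 12 * c1 x + c2 x)
      \<le> 9 * ennreal (eps S n) + 5 * ennreal (eps S n) + 12 * ennreal (eps S n) + ennreal (eps S n)"
    by (intro Lq_size_add_le_add Lq_size_cmult_le q Lz) measurable
  \<comment> \<open>The coefficients 9, 5, 12 and 1 add up to 27, below the 30 in
    \<open>nu\<close>.\<close>
  also have "\<dots> \<le> ennreal (30 * eps S n)"
    using eps by (simp flip: ennreal_plus ennreal_mult ennreal_numeral)
  finally show ?U
    using dev delta by (intro Lq_size_markov[OF q mset]) auto
qed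

section \<open>The risk bound for the selected estimator\<close>

theorem theorem2:
  fixes S :: "('w, 'x, 'y, 'f, 'h, 's, 't) selection_model"
    and C :: real
    and eps' :: "nat \<Rightarrow> real"
    and hhat :: "nat \<Rightarrow> 'x \<Rightarrow> 'h"
  assumes "is_selection_model S"
    and "permutation_hyp S"
    and "upper_function_hyp S"
    and "1 \<le> C" and "concentration_hyp S C"
    and "\<And>n. n \<ge> 1 \<Longrightarrow> 0 < delta S n"
    and "selection_rule S eps' hhat"
    and "\<And>n. n \<ge> 1 \<Longrightarrow> eps' n \<le> eps S n"
    and "\<And>n. n \<ge> 1 \<Longrightarrow> ennreal (eps' n) \<le> delta S n / 4"
    and "\<And>n f. n \<ge> 1 \<Longrightarrow> f \<in> funcs S \<Longrightarrow>
           (\<lambda>\<omega>. rho S (Bhat S n (hhat n (X1 S n \<omega>)) (X2 S n \<omega>)) (Bmap S f))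
             \<in> borel_measurable (pmeas S n f)"
  shows "\<forall>f\<in>funcs S. \<forall>n\<ge>1.
           risk_B S n (\<lambda>x y. Bhat S n (hhat n x) y) f \<le> nu S C n f + tau S C n f"
proof (intro ballI allI impI)
  fix f and n :: nat assume f: "f \<in> funcs S" and n: "1 \<le> n"
  let ?q = "qexp S" and ?M = "pmeas S n f" and ?H = "grid S n"
  let ?L = "law1 S n f" and ?O = "obs1 S n"
  note model' = assms(1)[unfolded is_selection_model_def] n f
  interpret P: prob_space ?M using model' by simp
  have q: "1 \<le> ?q" and cnt: "countable ?H" and setsM: "sets ?M = sets (sample S n)"
    using model' by auto
  have spaceM: "space ?M = space (sample S n)"
    using setsM by (rule sets_eq_imp_space_eq)
  have X [measurable]: "X1 S n \<in> ?M \<rightarrow>\<^sub>M ?O" "X2 S n \<in> ?M \<rightarrow>\<^sub>M obs2 S n"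
    using model' by (auto simp: measurable_cong_sets[OF setsM refl])
  interpret L: prob_space ?L
    unfolding law1_def by (rule P.prob_space_distr) (rule X)
  have hhat [measurable]: "hhat n \<in> ?O \<rightarrow>\<^sub>M count_space ?H"
    using assms(7) n by (simp add: selection_rule_def)
  have par: "h \<in> params S" if "h \<in> ?H" for h
    using model' that by auto
  \<comment> \<open>The generated sigma-algebras become families of preimages, the form in which
    independence enters \<open>Lq_size_random_index\<close>.\<close>
  have ind: "P.indep_set {X1 S n -` A \<inter> space ?M | A. A \<in> sets ?O}
      {X2 S n -` B \<inter> space ?M | B. B \<in> sets (obs2 S n)}"
  proof -
    have "X1 S n \<in> space (sample S n) \<rightarrow> space ?O" "X2 S n \<in> space (sample S n) \<rightarrow> space (obs2 S n)"
      using measurable_space[OF X(1)] measurable_space[OF X(2)] by (auto simp: spaceM)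
    moreover have "P.indep_set (sets (vimage_algebra (space (sample S n)) (X1 S n) ?O))
        (sets (vimage_algebra (space (sample S n)) (X2 S n) (obs2 S n)))"
      using model' by blast
    ultimately show ?thesis
      by (simp only: sets_vimage_algebra2 spaceM)
  qed
  let ?r = "\<lambda>h y. ennreal (rho S (Bhat S n h y) (Ups S n h f))"
  let ?s = "\<lambda>h. ennreal (rho S (Ups S n h f) (Bmap S f))"
  have mr: "?r h \<in> borel_measurable (obs2 S n)" if "h \<in> ?H" for h
    using model' that by (auto intro: measurable_compose[OF _ measurable_ennreal])
  have NX: "(\<lambda>\<omega>. hhat n (X1 S n \<omega>)) \<in> ?M \<rightarrow>\<^sub>M count_space ?H"
    by (rule measurable_compose[OF X(1) hhat])
  have grid: "hhat n x \<in> ?H" if "x \<in> space ?O" for x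
    using measurable_space[OF hhat that] by simp
  have err: "Lq_size ?M ?q (\<lambda>\<omega>. ?r (hhat n (X1 S n \<omega>)) (X2 S n \<omega>))
      = Lq_size ?L ?q (\<lambda>x. err S n f (hhat n x))"
    unfolding law1_def err_def law2_def
    by (rule P.Lq_size_random_index[OF ind X cnt hhat mr q])
  have bias: "Lq_size ?M ?q (\<lambda>\<omega>. ?s (hhat n (X1 S n \<omega>))) = Lq_size ?L ?q (\<lambda>x. ?s (hhat n x))"
    unfolding law1_def by (rule Lq_size_distr[symmetric, OF X(1)]) (rule measurable_compose[OF hhat], simp)
  \<comment> \<open>The intermediate point \<open>Ups\<close> at the selected index splits the loss
    into a bias part, governed by \<open>UU\<close>, and a stochastic part, governed by
    \<open>VV\<close>.\<close>
  have tri: "ennreal (rho S (Bhat S n (hhat n (X1 S n \<omega>)) (X2 S n \<omega>)) (Bmap S f))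
      \<le> ?s (hhat n (X1 S n \<omega>)) + ?r (hhat n (X1 S n \<omega>)) (X2 S n \<omega>)" if \<omega>: "\<omega> \<in> space ?M" for \<omega>
  proof -
    let ?h = "hhat n (X1 S n \<omega>)"
    have h: "?h \<in> params S"
      by (intro par grid measurable_space[OF X(1) \<omega>])
    have sp: "Bhat S n ?h (X2 S n \<omega>) \<in> space (val2 S)" "Ups S n ?h f \<in> space (val2 S)"
      "Bmap S f \<in> space (val2 S)"
      using model' h measurable_space[OF X(2) \<omega>] by (blast intro: measurable_space)+
    have sm: "semimetric_on (space (val2 S)) (rho S)" using model' by simp
    have "rho S (Bhat S n ?h (X2 S n \<omega>)) (Bmap S f)
        \<le> rho S (Ups S n ?h f) (Bmap S f) + rho S (Bhat S n ?h (X2 S n \<omega>)) (Ups S n ?h f)"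
      and "0 \<le> rho S (Ups S n ?h f) (Bmap S f)" "0 \<le> rho S (Bhat S n ?h (X2 S n \<omega>)) (Ups S n ?h f)"
      using sm sp unfolding semimetric_on_def by (simp_all add: add.commute)
    then show ?thesis by (simp flip: ennreal_plus)
  qed
  have mset: "{x \<in> space ?O. hhat n x \<notin> T} \<in> sets ?L" for T
    using sets_index_notin[OF hhat] by (simp add: law1_def)
  note probs = selection_probabilities[OF assms(1-5) assms(6)[OF n] assms(7) assms(9)[OF n] n f]
  \<comment> \<open>Off the exceptional event the selected index lies in \<open>UU\<close> and the
    first supremum in \<open>nu\<close> applies; on it, the supremum over the whole grid is weighted
    by the \<open>q\<close>-th root of the probability. The same split with \<open>VV\<close> gives
    \<open>tau\<close>.\<close>
  have "Lq_size ?L ?q (\<lambda>x. ?s (hhat n x)) \<le> nu S C n f"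
    unfolding nu_def
    by (rule L.Lq_size_two_level[OF q mset _ _ probs(2)])
       (auto simp: law1_def intro!: SUP_upper grid)
  moreover have "Lq_size ?L ?q (\<lambda>x. err S n f (hhat n x)) \<le> tau S C n f"
    unfolding tau_def
    by (rule L.Lq_size_two_level[OF q mset _ _ probs(1)])
       (auto simp: law1_def intro!: SUP_upper grid)
  ultimately have "Lq_size ?M ?q (\<lambda>\<omega>. ?s (hhat n (X1 S n \<omega>)) + ?r (hhat n (X1 S n \<omega>)) (X2 S n \<omega>))
      \<le> nu S C n f + tau S C n f"
    unfolding err[symmetric] bias[symmetric]
    by (intro Lq_size_add_le_add[OF q] measurable_compose_countable'[OF measurable_compose[OF X(2) mr] NX cnt]
        measurable_compose[OF NX]) auto
  moreover have "risk_B S n (\<lambda>x y. Bhat S n (hhat n x) y) f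
      \<le> Lq_size ?M ?q (\<lambda>\<omega>. ?s (hhat n (X1 S n \<omega>)) + ?r (hhat n (X1 S n \<omega>)) (X2 S n \<omega>))"
    unfolding risk_B_def using q tri by (rule Lq_size_mono)
  ultimately show "risk_B S n (\<lambda>x y. Bhat S n (hhat n x) y) f \<le> nu S C n f + tau S C n f"
    by simp
qed

end
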